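(* Let $\mathcal H$ be a real Hilbert space and let $f:\mathcal H\to\mathbb R$ be a $\mathcal C^1$ convex function whose gradient is $L$-Lipschitz continuous and such that $\operatorname{argmin}_{\mathcal H} f\neq\emptyset$; let $x^\star\in\operatorname{argmin}_{\mathcal H} f$. Let $(x_k)$ be a sequence generated by (NAG$_\alpha$) with step size $s>0$, where $\alpha\ge3$ and $sL<1$. Then $$\sum_k k^2\|\nabla f(x_k)\|^2<+\infty .$$ In addition, when $\alpha>3$, $$\sum_k k\bigl(f(x_k)-f(x^\star)\bigr)<+\infty .$$
   Context: The Nesterov accelerated gradient algorithm (NAG$_\alpha$) with step size $s>0$ is the recursion, started from two arbitrary points $x_0,x_1\in\mathcal H$ and run for $k\ge1$, $$y_k=x_k+\left(1-\tfrac{\alpha}{k}\right)(x_k-x_{k-1}),\qquad x_{k+1}=y_k-s\nabla f(y_k).$$ *)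

theory Defs
  imports "HOL-Analysis.Analysis"
begin

definition argmin_set :: "('a \<Rightarrow> real) \<Rightarrow> 'a set" where
  "argmin_set f = {x. is_arg_min f (\<lambda>_. True) x}"

(* The second argument g plays the role of the gradient of the objective.
   The points x 0 and x 1 are unconstrained, and so is the value y 0, which
   does not occur in the recursion. *)
definition nag_sequence ::
    "real \<Rightarrow> ('a::real_inner \<Rightarrow> 'a) \<Rightarrow> real \<Rightarrow> (nat \<Rightarrow> 'a) \<Rightarrow> bool" where
  "nag_sequence \<alpha> g s x \<longleftrightarrow>
     (\<exists>y. \<forall>k\<ge>1.
        y k = x k + (1 - \<alpha> / real k) *\<^sub>R (x k - x (k - 1)) \<and>
        x (k + 1) = y k - s *\<^sub>R g (y k))"

end

theory Submission
  imports Defs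
begin

text \<open>
  The proof is a Lyapunov argument. Put \<open>t\<^sub>k = (k - 1) / (\<alpha> - 1)\<close>, so that the inertial coefficient
  is \<open>1 - \<alpha> / k = (t\<^sub>k - 1) / t\<^sub>k\<^sub>+\<^sub>1\<close>. The energy
  \<open>E\<^sub>k = t\<^sub>k\<^sup>2 (f x\<^sub>k - f x\<^sup>\<star>) + \<parallel>x\<^sub>k\<^sub>-\<^sub>1 - x\<^sup>\<star> + t\<^sub>k (x\<^sub>k - x\<^sub>k\<^sub>-\<^sub>1)\<parallel>\<^sup>2 / (2 s)\<close> then satisfies, as soon as
  \<open>t\<^sub>k\<^sub>+\<^sub>1 \<ge> 1\<close>,
  \<open>E\<^sub>k\<^sub>+\<^sub>1 + (t\<^sub>k\<^sup>2 - t\<^sub>k\<^sub>+\<^sub>1\<^sup>2 + t\<^sub>k\<^sub>+\<^sub>1) (f x\<^sub>k - f x\<^sup>\<star>) + m t\<^sub>k\<^sub>+\<^sub>1\<^sup>2 \<parallel>\<nabla>f y\<^sub>k\<parallel>\<^sup>2 \<le> E\<^sub>k\<close> with \<open>m = s (1 - s L) / 2\<close>.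
  This is lemma \<open>accelerated_step_energy\<close>, fed with lemma \<open>gradient_step_decrease\<close> at the two
  points \<open>x\<^sub>k\<close> and \<open>x\<^sup>\<star>\<close>.
  The constant \<open>m\<close> is what the descent lemma leaves over when \<open>s L < 1\<close> strictly, and
  \<open>t\<^sub>k\<^sup>2 - t\<^sub>k\<^sub>+\<^sub>1\<^sup>2 + t\<^sub>k\<^sub>+\<^sub>1 = ((\<alpha> - 3) k + 1) / (\<alpha> - 1)\<^sup>2\<close>
  is nonnegative for \<open>\<alpha> \<ge> 3\<close> and of order \<open>k\<close> for \<open>\<alpha> > 3\<close>. As the energy is nonnegative, both
  decrements are summable (lemma \<open>summable_decrease\<close>): the one in the values gives the claim for
  \<open>\<alpha> > 3\<close>, and the one in the gradients gives the summability of \<open>k\<^sup>2 \<parallel>\<nabla>f y\<^sub>k\<parallel>\<^sup>2\<close>.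

  The gradients at \<open>x\<^sub>k\<close> come for free: \<open>x\<^sub>k\<^sub>+\<^sub>1\<close> is at distance \<open>s \<parallel>\<nabla>f y\<^sub>k\<parallel>\<close> from \<open>y\<^sub>k\<close>, so the
  Lipschitz condition gives \<open>\<parallel>\<nabla>f x\<^sub>k\<^sub>+\<^sub>1\<parallel> \<le> (1 + s L) \<parallel>\<nabla>f y\<^sub>k\<parallel> \<le> 2 \<parallel>\<nabla>f y\<^sub>k\<parallel>\<close>.
\<close>

lemma has_real_derivative_along_line:
  fixes f :: "'a::real_inner \<Rightarrow> real"
  assumes "GDERIV f (y + r *\<^sub>R h) :> d"
  shows "((\<lambda>r. f (y + r *\<^sub>R h)) has_real_derivative d \<bullet> h) (at r)"
proof -
  have "((\<lambda>r. y + r *\<^sub>R h) has_derivative (\<lambda>r. r *\<^sub>R h)) (at r)"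
    by (auto intro!: derivative_eq_intros)
  moreover have "(f has_derivative (\<lambda>h. h \<bullet> d)) (at (y + r *\<^sub>R h))"
    using assms by (simp add: gderiv_def)
  ultimately have "((\<lambda>r. f (y + r *\<^sub>R h)) has_derivative (\<lambda>r. (r *\<^sub>R h) \<bullet> d)) (at r)"
    by (rule has_derivative_compose)
  then show ?thesis
    by (simp add: has_field_derivative_def inner_commute mult.commute[of _ "d \<bullet> h"] fun_eq_iff)
qed

lemma convex_on_gradient_inequality:
  fixes f :: "'a::real_inner \<Rightarrow> real"
  assumes "convex_on UNIV f" and "GDERIV f y :> d"
  shows "f y + d \<bullet> (z - y) \<le> f z"
proof -
  define \<phi> where "\<phi> = (\<lambda>r. f (y + r *\<^sub>R (z - y)))"
  have "convex_on UNIV \<phi>"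
  proof (rule convex_onI)
    fix t a b :: real
    assume "0 < t" "t < 1"
    moreover have "y + ((1 - t) *\<^sub>R a + t *\<^sub>R b) *\<^sub>R (z - y)
        = (1 - t) *\<^sub>R (y + a *\<^sub>R (z - y)) + t *\<^sub>R (y + b *\<^sub>R (z - y))"
      by (simp add: algebra_simps)
    ultimately show "\<phi> ((1 - t) *\<^sub>R a + t *\<^sub>R b) \<le> (1 - t) * \<phi> a + t * \<phi> b"
      unfolding \<phi>_def using convex_onD[OF assms(1), of t] by simp
  qed simp
  moreover have "(\<phi> has_real_derivative d \<bullet> (z - y)) (at 0)"
    unfolding \<phi>_def by (rule has_real_derivative_along_line) (use assms(2) in simp)
  ultimately have "\<phi> 1 - \<phi> 0 \<ge> d \<bullet> (z - y) * (1 - 0)"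
    by (intro convex_on_imp_above_tangent[of UNIV]) auto
  then show ?thesis by (simp add: \<phi>_def)
qed

text \<open>
  Along the segment the slope of \<open>f\<close> exceeds its initial value \<open>\<nabla>f y \<bullet> h\<close> by at most
  \<open>L r \<parallel>h\<parallel>\<^sup>2\<close>, so \<open>f\<close> minus the quadratic model is nonincreasing there.
\<close>

lemma lipschitz_gradient_quadratic_upper_bound:
  fixes f :: "'a::real_inner \<Rightarrow> real"
  assumes grad: "\<And>z. GDERIV f z :> g z" and lip: "L-lipschitz_on UNIV g"
  shows "f (y + h) \<le> f y + g y \<bullet> h + L / 2 * (norm h)\<^sup>2"
proof -
  define \<psi> where "\<psi> = (\<lambda>r. f (y + r *\<^sub>R h) - r * (g y \<bullet> h) - L / 2 * r\<^sup>2 * (norm h)\<^sup>2)"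
  have "\<psi> 1 \<le> \<psi> 0"
  proof (rule DERIV_nonpos_imp_nonincreasing[of 0 1 \<psi>])
    fix r :: real
    assume r: "0 \<le> r" "r \<le> 1"
    let ?d = "g (y + r *\<^sub>R h) \<bullet> h - g y \<bullet> h - L * r * (norm h)\<^sup>2"
    have "(\<psi> has_real_derivative ?d) (at r)"
      unfolding \<psi>_def
      by (rule derivative_eq_intros has_real_derivative_along_line[OF grad] refl)+ simp
    moreover have "?d \<le> 0"
    proof -
      have "(g (y + r *\<^sub>R h) - g y) \<bullet> h \<le> norm (g (y + r *\<^sub>R h) - g y) * norm h"
        by (rule norm_cauchy_schwarz)
      also have "\<dots> \<le> (L * (r * norm h)) * norm h"
        using lipschitz_onD[OF lip, of "y + r *\<^sub>R h" y] r
        by (intro mult_right_mono) (auto simp: dist_norm)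
      finally show ?thesis by (simp add: inner_diff_left power2_eq_square mult_ac)
    qed
    ultimately show "\<exists>d. (\<psi> has_real_derivative d) (at r) \<and> d \<le> 0" by blast
  qed simp
  then show ?thesis by (simp add: \<psi>_def)
qed

text \<open>
  A gradient step lowers \<open>f\<close> by at least \<open>(s / 2 + m) \<parallel>\<nabla>f y\<parallel>\<^sup>2\<close> from its value at \<open>y\<close>, and
  \<open>f y\<close> is compared with \<open>f z\<close> by the tangent plane at \<open>y\<close>. The part \<open>s / 2\<close> of the decrease is
  used up by the energy estimate; \<open>m\<close>, positive when \<open>s L < 1\<close>, is the surplus.
\<close>

lemma gradient_step_decrease:
  fixes f :: "'a::real_inner \<Rightarrow> real" and s L :: real
  assumes "convex_on UNIV f" and grad: "\<And>z. GDERIV f z :> g z"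
    and "L-lipschitz_on UNIV g"
  defines "m \<equiv> s * (1 - s * L) / 2"
  shows "f (y - s *\<^sub>R g y) \<le> f z + g y \<bullet> (y - z) - (s / 2 + m) * (norm (g y))\<^sup>2"
proof -
  have "f (y - s *\<^sub>R g y) \<le> f y - s * (norm (g y))\<^sup>2 + L / 2 * (s\<^sup>2 * (norm (g y))\<^sup>2)"
    using lipschitz_gradient_quadratic_upper_bound[OF grad assms(3), of y "- (s *\<^sub>R g y)"]
    by (simp add: power_mult_distrib power2_norm_eq_inner)
  moreover have "f y \<le> f z + g y \<bullet> (y - z)"
    using convex_on_gradient_inequality[OF assms(1) grad, of y z]
    by (simp add: inner_diff_right)
  ultimately show ?thesis
    by (simp add: m_def field_simps power2_eq_square)
qed

text \<open>
  One step of the energy estimate, with \<open>p = x\<^sub>k\<close>, \<open>t = t\<^sub>k\<^sub>+\<^sub>1\<close> and \<open>y - s g\<close> the next iterate. The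
  two hypotheses on \<open>f\<close> are combined with weights \<open>t (t - 1)\<close> and \<open>t\<close>; the inner products then add
  up to \<open>t g \<bullet> v\<close> with \<open>v = p - z + t (y - p)\<close>, and since the new vector in the energy is
  \<open>v - s t g\<close>, expanding its square absorbs \<open>t g \<bullet> v - t\<^sup>2 s \<parallel>g\<parallel>\<^sup>2 / 2\<close> exactly.
\<close>

lemma accelerated_step_energy:
  fixes p y z g :: "'a::real_inner" and f :: "'a \<Rightarrow> real" and s t m :: real
  defines "q \<equiv> y - s *\<^sub>R g"
  assumes "s > 0" and "t \<ge> 1"
    and p: "f q \<le> f p + g \<bullet> (y - p) - (s / 2 + m) * (norm g)\<^sup>2"
    and z: "f q \<le> f z + g \<bullet> (y - z) - (s / 2 + m) * (norm g)\<^sup>2"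
  shows "t\<^sup>2 * (f q - f z) + (norm (p - z + t *\<^sub>R (q - p)))\<^sup>2 / (2 * s) + m * t\<^sup>2 * (norm g)\<^sup>2
      \<le> t * (t - 1) * (f p - f z) + (norm (p - z + t *\<^sub>R (y - p)))\<^sup>2 / (2 * s)"
proof -
  define v where "v = p - z + t *\<^sub>R (y - p)"
  define G where "G = (norm g)\<^sup>2"
  define A where "A = g \<bullet> (y - p)"
  define B where "B = g \<bullet> (y - z)"
  have gv: "g \<bullet> v = (t - 1) * A + B"
    unfolding v_def A_def B_def by (simp add: inner_diff_right inner_add_right algebra_simps)
  have v_next: "p - z + t *\<^sub>R (q - p) = v - (s * t) *\<^sub>R g"
    unfolding v_def q_def by (simp add: algebra_simps)
  have "(norm (p - z + t *\<^sub>R (q - p)))\<^sup>2 = (norm v)\<^sup>2 - 2 * (s * t) * (g \<bullet> v) + (s * t)\<^sup>2 * G"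
    unfolding v_next G_def power2_norm_eq_inner
    by (simp add: inner_diff_right inner_diff_left inner_commute power2_eq_square algebra_simps)
  then have norm_eq: "(norm (p - z + t *\<^sub>R (q - p)))\<^sup>2 / (2 * s)
      = (norm v)\<^sup>2 / (2 * s) - t * (g \<bullet> v) + s / 2 * t\<^sup>2 * G"
    using \<open>s > 0\<close> by (simp add: field_simps power2_eq_square)
  define S where "S = (s / 2 + m) * G"
  have "t * (t - 1) * f q \<le> t * (t - 1) * (f p + A - S)"
    using p \<open>t \<ge> 1\<close> unfolding A_def G_def S_def by (intro mult_left_mono) auto
  moreover have "t * f q \<le> t * (f z + B - S)"
    using z \<open>t \<ge> 1\<close> unfolding B_def G_def S_def by (intro mult_left_mono) auto
  ultimately have "t * (t - 1) * f q + t * f q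
      \<le> t * (t - 1) * (f p + A - S) + t * (f z + B - S)"
    by (rule add_mono)
  then have "t\<^sup>2 * (f q - f z) \<le> t * (t - 1) * (f p - f z) + t * (g \<bullet> v) - t\<^sup>2 * S"
    unfolding gv by (simp add: algebra_simps power2_eq_square)
  then show ?thesis
    unfolding norm_eq v_def[symmetric] G_def[symmetric] S_def by (simp add: algebra_simps)
qed

lemma summable_decrease:
  fixes E a :: "nat \<Rightarrow> real"
  assumes E: "\<And>k. k \<ge> N \<Longrightarrow> 0 \<le> E k" and a: "\<And>k. k \<ge> N \<Longrightarrow> 0 \<le> a k"
    and decr: "\<And>k. k \<ge> N \<Longrightarrow> E (Suc k) + a k \<le> E k"
  shows "summable a"
proof -
  have telescope: "(\<Sum>k<n. a (k + N)) \<le> E N - E (n + N)" for n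
  proof (induction n)
    case (Suc n)
    then show ?case using decr[of "n + N"] by simp
  qed simp
  have "summable (\<lambda>k. a (k + N))"
  proof (rule summableI_nonneg_bounded)
    show "(\<Sum>k<n. a (k + N)) \<le> E N" for n
      using telescope[of n] E[of "n + N"] by simp
  qed (use a in simp)
  then show ?thesis by (simp only: summable_iff_shift)
qed

theorem theorem5p2:
  fixes f :: "'a::{real_inner, complete_space} \<Rightarrow> real"
    and grad_f :: "'a \<Rightarrow> 'a"
    and x :: "nat \<Rightarrow> 'a"
    and x_star :: 'a
    and L s \<alpha> :: real
  assumes "convex_on UNIV f"
    and "\<And>z. GDERIV f z :> grad_f z"
    and "continuous_on UNIV grad_f"
    and "L-lipschitz_on UNIV grad_f"
    and "x_star \<in> argmin_set f"
    and "s > 0"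
    and "\<alpha> \<ge> 3"
    and "s * L < 1"
    and "nag_sequence \<alpha> grad_f s x"
  shows "summable (\<lambda>k. (real k)\<^sup>2 * (norm (grad_f (x k)))\<^sup>2) \<and>
         (\<alpha> > 3 \<longrightarrow> summable (\<lambda>k. real k * (f (x k) - f x_star)))"
proof -
  from assms(9) obtain y
    where y: "\<And>k. k \<ge> 1 \<Longrightarrow> y k = x k + (1 - \<alpha> / real k) *\<^sub>R (x k - x (k - 1))"
      and step: "\<And>k. k \<ge> 1 \<Longrightarrow> x (Suc k) = y k - s *\<^sub>R grad_f (y k)"
    unfolding nag_sequence_def by auto
  define m where "m = s * (1 - s * L) / 2"
  have m: "m > 0" using \<open>s > 0\<close> \<open>s * L < 1\<close> by (simp add: m_def)
  define W where "W = (\<lambda>k. f (x k) - f x_star)"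
  have W: "W k \<ge> 0" for k
    using assms(5) by (auto simp: W_def argmin_set_def is_arg_min_def not_less)
  define t where "t = (\<lambda>k. (real k - 1) / (\<alpha> - 1))"
  have t_Suc: "t (Suc k) = real k / (\<alpha> - 1)" for k by (simp add: t_def)
  define G where "G = (\<lambda>k. (norm (grad_f (y k)))\<^sup>2)"
  define v where "v = (\<lambda>k. x (k - 1) - x_star + t k *\<^sub>R (x k - x (k - 1)))"
  define E where "E = (\<lambda>k. (t k)\<^sup>2 * W k + (norm (v k))\<^sup>2 / (2 * s))"
  define a where "a = (\<lambda>k. ((\<alpha> - 3) * real k + 1) / (\<alpha> - 1)\<^sup>2 * W k)"
  define b where "b = (\<lambda>k. m * (t (Suc k))\<^sup>2 * G k)"
  have E_nonneg: "0 \<le> E k" for k using W \<open>s > 0\<close> by (simp add: E_def)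
  have a_nonneg: "0 \<le> a k" for k using W \<open>\<alpha> \<ge> 3\<close> by (simp add: a_def)
  have b_nonneg: "0 \<le> b k" for k using m by (simp add: b_def G_def)
  \<comment> \<open>From this index on \<open>t\<^sub>k\<^sub>+\<^sub>1 \<ge> 1\<close>, so that the weight \<open>t (t - 1)\<close> is nonnegative.\<close>
  define N where "N = nat \<lceil>\<alpha> - 1\<rceil>"
  have energy: "E (Suc k) + (a k + b k) \<le> E k" if "k \<ge> N" for k
  proof -
    have kN: "real k \<ge> \<alpha> - 1" using that unfolding N_def by linarith
    then have k: "k \<ge> 1" using \<open>\<alpha> \<ge> 3\<close> by linarith
    have t: "t (Suc k) \<ge> 1" using kN \<open>\<alpha> \<ge> 3\<close> by (simp add: t_Suc)
    have "t (Suc k) * (1 - \<alpha> / real k) = t k - 1"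
      using k \<open>\<alpha> \<ge> 3\<close> by (simp add: t_Suc t_def field_simps)
    then have "t (Suc k) *\<^sub>R (y k - x k) = (t k - 1) *\<^sub>R (x k - x (k - 1))"
      by (simp add: y[OF k])
    then have v: "x k - x_star + t (Suc k) *\<^sub>R (y k - x k) = v k"
      by (simp add: v_def algebra_simps)
    have "t (Suc k) * (t (Suc k) - 1) = (t k)\<^sup>2 - ((\<alpha> - 3) * real k + 1) / (\<alpha> - 1)\<^sup>2"
    proof -
      have "\<alpha> - 1 \<noteq> 0" using \<open>\<alpha> \<ge> 3\<close> by simp
      then have "t (Suc k) * (t (Suc k) - 1) * (\<alpha> - 1)\<^sup>2
          = ((t k)\<^sup>2 - ((\<alpha> - 3) * real k + 1) / (\<alpha> - 1)\<^sup>2) * (\<alpha> - 1)\<^sup>2"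
        unfolding t_Suc t_def
        by (simp add: power_divide left_diff_distrib diff_divide_distrib)
          (simp add: divide_simps, simp add: power2_eq_square algebra_simps)
      with \<open>\<alpha> - 1 \<noteq> 0\<close> show ?thesis by simp
    qed
    then have a: "t (Suc k) * (t (Suc k) - 1) * W k = (t k)\<^sup>2 * W k - a k"
      by (simp add: a_def left_diff_distrib)
    have decrease: "f (y k - s *\<^sub>R grad_f (y k))
        \<le> f z + grad_f (y k) \<bullet> (y k - z) - (s / 2 + m) * (norm (grad_f (y k)))\<^sup>2" for z
      unfolding m_def by (rule gradient_step_decrease[OF assms(1,2,4)])
    from accelerated_step_energy[where f = f and p = "x k" and z = x_star,
        OF \<open>s > 0\<close> t decrease decrease]
    have "(t (Suc k))\<^sup>2 * W (Suc k) + (norm (v (Suc k)))\<^sup>2 / (2 * s) + b k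
        \<le> t (Suc k) * (t (Suc k) - 1) * W k + (norm (v k))\<^sup>2 / (2 * s)"
      unfolding step[OF k, symmetric] v by (simp add: v_def b_def G_def W_def)
    then show ?thesis unfolding a E_def by simp
  qed
  have sum_a: "summable a"
    using energy b_nonneg
    by (intro summable_decrease[where E = E and N = N, OF E_nonneg a_nonneg])
      (meson add_left_mono le_add_same_cancel1 order_trans)
  have sum_b: "summable b"
    using energy a_nonneg
    by (intro summable_decrease[where E = E and N = N, OF E_nonneg b_nonneg])
      (meson add_left_mono le_add_same_cancel2 order_trans)

  have "summable (\<lambda>k. (real (Suc k))\<^sup>2 * (norm (grad_f (x (Suc k))))\<^sup>2)"
  proof (rule summable_comparison_test')
    show "summable (\<lambda>k. 16 * ((\<alpha> - 1)\<^sup>2 / m) * b k)"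
      using sum_b by (rule summable_mult)
    fix k :: nat
    assume k: "k \<ge> 1"
    have "norm (grad_f (x (Suc k)) - grad_f (y k)) \<le> L * norm (s *\<^sub>R grad_f (y k))"
      using lipschitz_onD[OF assms(4), of "x (Suc k)" "y k"] by (simp add: step[OF k] dist_norm)
    also have "\<dots> = (s * L) * norm (grad_f (y k))" using \<open>s > 0\<close> by simp
    also have "\<dots> \<le> 1 * norm (grad_f (y k))"
      using \<open>s * L < 1\<close> by (intro mult_right_mono) auto
    finally have "norm (grad_f (x (Suc k))) \<le> 2 * norm (grad_f (y k))"
      using norm_triangle_sub[of "grad_f (x (Suc k))" "grad_f (y k)"] by simp
    moreover have "real (Suc k) \<le> 2 * real k" using k by simp
    ultimately have "(real (Suc k) * norm (grad_f (x (Suc k))))\<^sup>2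
        \<le> ((2 * real k) * (2 * norm (grad_f (y k))))\<^sup>2"
      by (intro power_mono mult_mono) auto
    also have "\<dots> = 16 * ((\<alpha> - 1)\<^sup>2 / m) * b k"
      using m \<open>\<alpha> \<ge> 3\<close> by (simp add: b_def t_Suc G_def power_mult_distrib power_divide)
    finally show "norm ((real (Suc k))\<^sup>2 * (norm (grad_f (x (Suc k))))\<^sup>2)
        \<le> 16 * ((\<alpha> - 1)\<^sup>2 / m) * b k"
      by (simp add: power_mult_distrib)
  qed
  then have gradients: "summable (\<lambda>k. (real k)\<^sup>2 * (norm (grad_f (x k)))\<^sup>2)"
    by (subst (asm) summable_Suc_iff)

  have "summable (\<lambda>k. real k * W k)" if "\<alpha> > 3"
  proof (rule summable_comparison_test')
    show "summable (\<lambda>k. (\<alpha> - 1)\<^sup>2 / (\<alpha> - 3) * a k)"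
      using sum_a by (rule summable_mult)
    fix k :: nat
    assume "k \<ge> 0"
    have "(\<alpha> - 1)\<^sup>2 / (\<alpha> - 3) * a k = ((\<alpha> - 3) * real k + 1) / (\<alpha> - 3) * W k"
      using that by (simp add: a_def)
    also have "\<dots> = (real k + 1 / (\<alpha> - 3)) * W k"
      using that by (simp add: add_divide_distrib)
    also have "\<dots> \<ge> real k * W k"
      using that W by (intro mult_right_mono) auto
    finally show "norm (real k * W k) \<le> (\<alpha> - 1)\<^sup>2 / (\<alpha> - 3) * a k"
      using W[of k] by simp
  qed
  with gradients show ?thesis unfolding W_def by blast
qed

end
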